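(* Let $(X,\|\cdot\|)$ be a real Banach space and let $T:X\to X$ be an enriched $\mathcal{A}'$-contraction. Then $T$ has a unique fixed point in $X$, and there exists $\lambda\in(0,1]$ such that, for any $u_0\in X$, the sequence $\{u_n\}$ defined by $u_{n+1}=(1-\lambda)u_n+\lambda Tu_n$, $n\ge 0$, converges to that fixed point.
   Context: Write $\mathbb{R}_+=[0,\infty)$. Let $\mathcal{A}'$ be the collection of all mappings $f:\mathbb{R}_+^3\to\mathbb{R}$ satisfying: ($\mathcal{A}'_1$) $f$ is continuous; ($\mathcal{A}'_2$) there exists $k\in[0,1)$ such that for all $r,s\in\mathbb{R}_+$: if $r\le f(r,s,s)$ or $r\le f(s,s,r)$, then $r\le ks$; ($\mathcal{A}'_3$) for all $\lambda>0$ and all $r,s,t\in\mathbb{R}_+$, $\lambda f(r,s,t)\le f(\lambda r,\lambda s,\lambda t)$; ($\mathcal{A}'_4$) for all $r,s,t,t_1\in\mathbb{R}_+$, if $t\le t_1$, then $f(r,s,t)\le f(r,s,t_1)$; ($\mathcal{A}'_5$) there exists $k\in[0,1)$ such that for all $r,s\in\mathbb{R}_+$: if $r\le f(s,0,r+s)$, then $r\le ks$; ($\mathcal{A}'_6$) for all $r\in\mathbb{R}_+$, if $r\le f(r,r,r)$, then $r=0$. Let $(X,\|\cdot\|)$ be a real Banach space. A mapping $T:X\to X$ is called an enriched $\mathcal{A}'$-contraction if there exist $b\in[0,\infty)$ and $f\in\mathcal{A}'$ such that $$\|b(u-v)+Tu-Tv\|\le f\big((b+1)\|u-v\|,\ \|(b+1)(u-v)+v-Tv\|,\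 \|(b+1)(v-u)+u-Tu\|\big)$$ for all $u,v\in X$ with $u\ne v$. *)

theory Defs
  imports "HOL-Analysis.Analysis"
begin

(* A map on [0,\<infinity>)^3 is encoded as a curried total function on the reals; every condition
   is restricted to nonnegative arguments, so values elsewhere are irrelevant. *)
definition class_A' :: "(real \<Rightarrow> real \<Rightarrow> real \<Rightarrow> real) set" where
  "class_A' = {f.
     continuous_on ({0..} \<times> {0..} \<times> {0..}) (\<lambda>(r, s, t). f r s t) \<and>
     (\<exists>k\<in>{0..<1}. \<forall>r\<ge>0. \<forall>s\<ge>0. r \<le> f r s s \<or> r \<le> f s s r \<longrightarrow> r \<le> k * s) \<and>
     (\<forall>l>0. \<forall>r\<ge>0. \<forall>s\<ge>0. \<forall>t\<ge>0. l * f r s t \<le> f (l * r) (l * s) (l * t)) \<and>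
     (\<forall>r\<ge>0. \<forall>s\<ge>0. \<forall>t\<ge>0. \<forall>t1\<ge>0. t \<le> t1 \<longrightarrow> f r s t \<le> f r s t1) \<and>
     (\<exists>k\<in>{0..<1}. \<forall>r\<ge>0. \<forall>s\<ge>0. r \<le> f s 0 (r + s) \<longrightarrow> r \<le> k * s) \<and>
     (\<forall>r\<ge>0. r \<le> f r r r \<longrightarrow> r = 0)}"

definition enriched_A'_contraction :: "('a::real_normed_vector \<Rightarrow> 'a) \<Rightarrow> bool" where
  "enriched_A'_contraction T \<longleftrightarrow>
     (\<exists>b\<ge>0. \<exists>f\<in>class_A'. \<forall>u v. u \<noteq> v \<longrightarrow>
        norm (b *\<^sub>R (u - v) + T u - T v)
          \<le> f ((b + 1) * norm (u - v))
              (norm ((b + 1) *\<^sub>R (u - v) + v - T v))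
              (norm ((b + 1) *\<^sub>R (v - u) + u - T u)))"

end

theory Submission
  imports Defs
begin

text \<open>
  Put \<open>l = 1 / (b + 1)\<close> and let \<open>S u = (1 - l) u + l T u\<close> be the averaged map. Since \<open>S\<close> moves
  each point by \<open>l\<close> times its displacement under \<open>T\<close>, the two maps have the same fixed points;
  and every norm in the enriched inequality for \<open>T\<close> is \<open>b + 1\<close> times a norm in
  \<open>\<parallel>S u - S v\<parallel> \<le> f \<parallel>u - v\<parallel> \<parallel>u - S v\<parallel> \<parallel>v - S u\<parallel>\<close>. Superhomogeneity of \<open>f\<close> removes that
  factor, so \<open>S\<close> satisfies the plain inequality, whose consequences can be read off
  (lemma \<open>averaged_contraction\<close> makes the reduction).

  For \<open>u = x\<^sub>n\<^sub>+\<^sub>1\<close> and \<open>v = x\<^sub>n\<close> on an orbit of \<open>S\<close> the second argument vanishes and the third is at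
  most the sum of two consecutive steps, so monotonicity in the third argument and the fifth condition
  on \<open>f\<close> make the step lengths decrease geometrically, and the orbit converges
  (\<open>averaged_orbit_convergent\<close>). Passing to the limit
  in the inequality between \<open>x\<^sub>n\<close> and the limit \<open>p\<close> gives \<open>\<parallel>S p - p\<parallel> \<le> f 0 0 \<parallel>p - S p\<parallel>\<close>, which the
  second condition on \<open>f\<close> only allows if \<open>S p = p\<close> (\<open>orbit_limit_is_fixed\<close>). Between two fixed
  points at distance \<open>r\<close> all three arguments equal \<open>r\<close>, so the last condition on \<open>f\<close> forces
  uniqueness.
\<close>

text \<open>
  The second fact is the case \<open>s = 0\<close> of the second condition, where the bound \<open>r \<le> k s\<close> collapses
  to \<open>r \<le> 0\<close> whatever \<open>k\<close> is.
\<close>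

lemma class_A'D:
  assumes "f \<in> class_A'"
  shows class_A'_continuous: "continuous_on ({0..} \<times> {0..} \<times> {0..}) (\<lambda>(r, s, t). f r s t)"
    and class_A'_third_arg_only: "\<And>r. \<lbrakk>0 \<le> r; r \<le> f 0 0 r\<rbrakk> \<Longrightarrow> r = 0"
    and class_A'_superhomogeneous:
      "\<And>l r s t. \<lbrakk>0 < l; 0 \<le> r; 0 \<le> s; 0 \<le> t\<rbrakk> \<Longrightarrow> l * f r s t \<le> f (l * r) (l * s) (l * t)"
    and class_A'_mono: "\<And>r s t t1. \<lbrakk>0 \<le> r; 0 \<le> s; 0 \<le> t; t \<le> t1\<rbrakk> \<Longrightarrow> f r s t \<le> f r s t1"
    and class_A'_diagonal: "\<And>r. \<lbrakk>0 \<le> r; r \<le> f r r r\<rbrakk> \<Longrightarrow> r = 0"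
proof -
  have cont: "continuous_on ({0..} \<times> {0..} \<times> {0..}) (\<lambda>(r, s, t). f r s t)"
    and ex: "\<exists>k\<in>{0..<1}. \<forall>r\<ge>0. \<forall>s\<ge>0. r \<le> f r s s \<or> r \<le> f s s r \<longrightarrow> r \<le> k * s"
    and hom: "\<forall>l>0. \<forall>r\<ge>0. \<forall>s\<ge>0. \<forall>t\<ge>0. l * f r s t \<le> f (l * r) (l * s) (l * t)"
    and mono: "\<forall>r\<ge>0. \<forall>s\<ge>0. \<forall>t\<ge>0. \<forall>t1\<ge>0. t \<le> t1 \<longrightarrow> f r s t \<le> f r s t1"
    and diag: "\<forall>r\<ge>0. r \<le> f r r r \<longrightarrow> r = 0"
    using assms unfolding class_A'_def mem_Collect_eq by - (elim conjE, assumption)+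
  show "continuous_on ({0..} \<times> {0..} \<times> {0..}) (\<lambda>(r, s, t). f r s t)"
    by (fact cont)
  show "r = 0" if "0 \<le> r" "r \<le> f 0 0 r" for r
  proof -
    obtain k where "\<forall>r\<ge>0. \<forall>s\<ge>0. r \<le> f r s s \<or> r \<le> f s s r \<longrightarrow> r \<le> k * s"
      using ex by (elim bexE)
    from this[rule_format, of r 0] that show ?thesis by simp
  qed
  show "l * f r s t \<le> f (l * r) (l * s) (l * t)" if "0 < l" "0 \<le> r" "0 \<le> s" "0 \<le> t" for l r s t
    using hom that by simp
  show "f r s t \<le> f r s t1" if "0 \<le> r" "0 \<le> s" "0 \<le> t" "t \<le> t1" for r s t t1
    using mono that by simp
  show "r = 0" if "0 \<le> r" "r \<le> f r r r" for r
    using diag that by simp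
qed

lemma class_A'_step_contraction:
  assumes "f \<in> class_A'"
  obtains k where "0 \<le> k" "k < 1"
    "\<forall>r\<ge>0. \<forall>s\<ge>0. r \<le> f s 0 (r + s) \<longrightarrow> r \<le> k * s"
proof -
  have "\<exists>k\<in>{0..<1}. \<forall>r\<ge>0. \<forall>s\<ge>0. r \<le> f s 0 (r + s) \<longrightarrow> r \<le> k * s"
    using assms unfolding class_A'_def mem_Collect_eq by (elim conjE)
  then show thesis
    using that by auto
qed

text \<open>
  Each vector in the enriched inequality is \<open>b + 1\<close> times the corresponding vector for the averaged
  map: \<open>b (u - v) + T u - T v = (b + 1) (S u - S v)\<close> and
  \<open>(b + 1) (u - v) + v - T v = (b + 1) (u - S v)\<close>.
\<close>

lemma averaged_contraction:
  fixes T :: "'a::real_normed_vector \<Rightarrow> 'a"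
  assumes "enriched_A'_contraction T"
  obtains f l where "f \<in> class_A'" "0 < l" "l \<le> 1"
    and "\<forall>u v. u \<noteq> v \<longrightarrow>
           norm (((1 - l) *\<^sub>R u + l *\<^sub>R T u) - ((1 - l) *\<^sub>R v + l *\<^sub>R T v))
             \<le> f (norm (u - v)) (norm (u - ((1 - l) *\<^sub>R v + l *\<^sub>R T v)))
                 (norm (v - ((1 - l) *\<^sub>R u + l *\<^sub>R T u)))"
proof -
  obtain b f where b: "b \<ge> 0" and f: "f \<in> class_A'" and
    T: "\<forall>u v. u \<noteq> v \<longrightarrow> norm (b *\<^sub>R (u - v) + T u - T v)
          \<le> f ((b + 1) * norm (u - v))
              (norm ((b + 1) *\<^sub>R (u - v) + v - T v))
              (norm ((b + 1) *\<^sub>R (v - u) + u - T u))"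
    using assms unfolding enriched_A'_contraction_def by (elim exE conjE bexE)
  define l where "l = 1 / (b + 1)"
  define S where "S u = (1 - l) *\<^sub>R u + l *\<^sub>R T u" for u
  have l: "0 < l" "l \<le> 1" and lb: "l * (b + 1) = 1"
    using b by (auto simp: l_def)
  have bl: "l * b = 1 - l" using lb by (simp add: algebra_simps)
  have diff: "S u - S v = l *\<^sub>R (b *\<^sub>R (u - v) + T u - T v)" for u v
    by (simp add: S_def scaleR_add_right scaleR_diff_right bl)
  have cross: "u - S v = l *\<^sub>R ((b + 1) *\<^sub>R (u - v) + v - T v)" for u v
    by (simp add: S_def scaleR_add_right scaleR_diff_right lb scaleR_left_diff_distrib)
  have "norm (S u - S v) \<le> f (norm (u - v)) (norm (u - S v)) (norm (v - S u))"
    if "u \<noteq> v" for u v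
  proof -
    have "norm (S u - S v) = l * norm (b *\<^sub>R (u - v) + T u - T v)"
      using l by (simp add: diff)
    also have "\<dots> \<le> l * f ((b + 1) * norm (u - v))
              (norm ((b + 1) *\<^sub>R (u - v) + v - T v))
              (norm ((b + 1) *\<^sub>R (v - u) + u - T u))"
      using T[rule_format, OF that] l by (intro mult_left_mono) auto
    also have "\<dots> \<le> f (l * ((b + 1) * norm (u - v)))
              (l * norm ((b + 1) *\<^sub>R (u - v) + v - T v))
              (l * norm ((b + 1) *\<^sub>R (v - u) + u - T u))"
      using b l by (intro class_A'_superhomogeneous[OF f]) auto
    also have "l * ((b + 1) * norm (u - v)) = norm (u - v)"
      using lb by (simp flip: mult.assoc)
    also have "l * norm ((b + 1) *\<^sub>R (u - v) + v - T v) = norm (u - S v)"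
      using l by (simp add: cross)
    also have "l * norm ((b + 1) *\<^sub>R (v - u) + u - T u) = norm (v - S u)"
      using l by (simp add: cross)
    finally show ?thesis .
  qed
  then show thesis
    unfolding S_def by (intro that[OF f l] allI impI)
qed

lemma averaged_fixed_iff:
  fixes x y :: "'a::real_vector"
  assumes "l \<noteq> 0"
  shows "(1 - l) *\<^sub>R x + l *\<^sub>R y = x \<longleftrightarrow> y = x"
proof -
  have "(1 - l) *\<^sub>R x + l *\<^sub>R y - x = l *\<^sub>R (y - x)"
    by (simp add: algebra_simps)
  then show ?thesis
    using assms by (metis eq_iff_diff_eq_0 scaleR_eq_0_iff)
qed

text \<open>
  Completeness enters here: the increments pass the ratio test, and an orbit is the telescoping sum
  of its increments.
\<close>

lemma convergent_if_increments_contract: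
  fixes x :: "nat \<Rightarrow> 'a::banach"
  assumes "k < 1"
    and "\<And>n. norm (x (Suc (Suc n)) - x (Suc n)) \<le> k * norm (x (Suc n) - x n)"
  shows "convergent x"
proof -
  have "summable (\<lambda>n. x (Suc n) - x n)"
    using assms by (intro summable_ratio_test[where c = k and N = 0]) auto
  then have "convergent (\<lambda>n. \<Sum>i<n. x (Suc i) - x i)"
    by (simp add: summable_iff_convergent)
  then have "convergent (\<lambda>n. x n - x 0)"
    by (simp add: sum_lessThan_telescope)
  then show ?thesis
    by (simp add: convergent_diff_const_right_iff)
qed

lemma averaged_orbit_convergent:
  fixes S :: "'a::banach \<Rightarrow> 'a"
  assumes f: "f \<in> class_A'"
    and S: "\<And>u v. u \<noteq> v \<Longrightarrow> norm (S u - S v) \<le> f (norm (u - v)) (norm (u - S v)) (norm (v - S u))"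
    and x: "\<And>n. x (Suc n) = S (x n)"
  shows "convergent x"
proof -
  obtain k where k: "0 \<le> k" "k < 1"
    "\<forall>r\<ge>0. \<forall>s\<ge>0. r \<le> f s 0 (r + s) \<longrightarrow> r \<le> k * s"
    by (rule class_A'_step_contraction[OF f])
  show ?thesis
  proof (rule convergent_if_increments_contract[OF \<open>k < 1\<close>])
    fix n
    let ?r = "norm (x (Suc (Suc n)) - x (Suc n))" and ?s = "norm (x (Suc n) - x n)"
    show "?r \<le> k * ?s"
    proof (cases "x (Suc n) = x n")
      case True
      then show ?thesis by (simp add: x)
    next
      case False
      have "?r \<le> f ?s 0 (norm (x n - x (Suc (Suc n))))"
        using S[OF False] by (simp flip: x)
      also have "\<dots> \<le> f ?s 0 (?r + ?s)"
      proof (rule class_A'_mono[OF f])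
        show "norm (x n - x (Suc (Suc n))) \<le> ?r + ?s"
          using norm_triangle_ineq[of "x (Suc (Suc n)) - x (Suc n)" "x (Suc n) - x n"]
          by (simp add: norm_minus_commute)
      qed auto
      finally show ?thesis using k by simp
    qed
  qed
qed

text \<open>
  \<open>S\<close> is not assumed continuous, so the fixed point equation comes from the limit of the contraction
  inequality. That inequality says nothing at indices where the orbit sits at its limit \<open>p\<close>; if there
  are infinitely many of these, the following terms all equal \<open>S p\<close> and converge to \<open>p\<close>.
\<close>

lemma orbit_limit_is_fixed:
  fixes S :: "'a::real_normed_vector \<Rightarrow> 'a"
  assumes f: "f \<in> class_A'"
    and S: "\<And>u v. u \<noteq> v \<Longrightarrow> norm (S u - S v) \<le> f (norm (u - v)) (norm (u - S v)) (norm (v - S u))"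
    and x: "\<And>n. x (Suc n) = S (x n)"
    and lim: "x \<longlonglongrightarrow> p"
  shows "S p = p"
proof (cases "\<forall>\<^sub>F n in sequentially. x n \<noteq> p")
  case True
  have lim': "(\<lambda>n. S (x n)) \<longlonglongrightarrow> p"
    using LIMSEQ_Suc[OF lim] by (simp add: x)
  have args: "(\<lambda>n. (norm (p - x n), norm (p - S (x n)), norm (x n - S p)))
                \<longlonglongrightarrow> (norm (p - p), norm (p - p), norm (p - S p))"
    by (intro tendsto_Pair tendsto_norm tendsto_diff tendsto_const lim lim')
  have "(\<lambda>n. f (norm (p - x n)) (norm (p - S (x n))) (norm (x n - S p))) \<longlonglongrightarrow> f 0 0 (norm (p - S p))"
    using continuous_on_tendsto_compose[OF class_A'_continuous[OF f] args] by simp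
  moreover have "(\<lambda>n. norm (S p - S (x n))) \<longlonglongrightarrow> norm (S p - p)"
    by (intro tendsto_norm tendsto_diff tendsto_const lim')
  moreover have "\<forall>\<^sub>F n in sequentially.
      norm (S p - S (x n)) \<le> f (norm (p - x n)) (norm (p - S (x n))) (norm (x n - S p))"
    using True by eventually_elim (rule S, simp)
  ultimately have "norm (S p - p) \<le> f 0 0 (norm (p - S p))"
    by (intro tendsto_le[OF trivial_limit_sequentially])
  then have "norm (p - S p) = 0"
    by (intro class_A'_third_arg_only[OF f]) (simp_all add: norm_minus_commute)
  then show ?thesis by simp
next
  case False
  show ?thesis
  proof (rule ccontr)
    assume "S p \<noteq> p"
    then have "\<forall>\<^sub>F n in sequentially. x (Suc n) \<noteq> S p"
      using tendsto_imp_eventually_ne[OF LIMSEQ_Suc[OF lim]] by metis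
    then have "\<forall>\<^sub>F n in sequentially. x n \<noteq> p"
      by eventually_elim (auto simp: x)
    with False show False by simp
  qed
qed

lemma averaged_fixed_unique:
  fixes S :: "'a::real_normed_vector \<Rightarrow> 'a"
  assumes f: "f \<in> class_A'"
    and S: "\<And>u v. u \<noteq> v \<Longrightarrow> norm (S u - S v) \<le> f (norm (u - v)) (norm (u - S v)) (norm (v - S u))"
    and "S p = p" "S q = q"
  shows "q = p"
proof (rule ccontr)
  assume "q \<noteq> p"
  then have "norm (q - p) \<le> f (norm (q - p)) (norm (q - p)) (norm (q - p))"
    using S[of q p] assms(3,4) by (simp add: norm_minus_commute)
  then have "norm (q - p) = 0"
    by (intro class_A'_diagonal[OF f]) auto
  with \<open>q \<noteq> p\<close> show False by simp
qed

theorem theorem3p2: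
  fixes T :: "'a::banach \<Rightarrow> 'a"
  assumes "enriched_A'_contraction T"
  shows "\<exists>p. T p = p \<and> (\<forall>q. T q = q \<longrightarrow> q = p) \<and>
           (\<exists>l\<in>{0<..1::real}. \<forall>u :: nat \<Rightarrow> 'a.
              (\<forall>n. u (Suc n) = (1 - l) *\<^sub>R u n + l *\<^sub>R T (u n)) \<longrightarrow> u \<longlonglongrightarrow> p)"
proof -
  obtain f l where f: "f \<in> class_A'" and l: "0 < l" "l \<le> 1"
    and S': "\<forall>u v. u \<noteq> v \<longrightarrow>
           norm (((1 - l) *\<^sub>R u + l *\<^sub>R T u) - ((1 - l) *\<^sub>R v + l *\<^sub>R T v))
             \<le> f (norm (u - v)) (norm (u - ((1 - l) *\<^sub>R v + l *\<^sub>R T v)))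
                 (norm (v - ((1 - l) *\<^sub>R u + l *\<^sub>R T u)))"
    by (rule averaged_contraction[OF assms])
  define S where "S u = (1 - l) *\<^sub>R u + l *\<^sub>R T u" for u
  note S = S'[rule_format, folded S_def]
  have fixed_iff: "S u = u \<longleftrightarrow> T u = u" for u
    using l by (simp add: S_def averaged_fixed_iff)
  have orbit: "\<exists>p. x \<longlonglongrightarrow> p \<and> S p = p" if x: "\<And>n. x (Suc n) = S (x n)" for x
  proof -
    obtain p where p: "x \<longlonglongrightarrow> p"
      using averaged_orbit_convergent[where f = f and S = S and x = x, OF f S x]
      by (auto simp: convergent_def)
    moreover have "S p = p"
      by (rule orbit_limit_is_fixed[where f = f and S = S and x = x, OF f S x p])
    ultimately show ?thesis by (intro exI conjI)
  qed
  obtain p where p: "S p = p"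
    using orbit[of "\<lambda>n. (S ^^ n) 0"] by auto
  have unique: "q = p" if "S q = q" for q
    using averaged_fixed_unique[where f = f and S = S, OF f S p that] .
  have "u \<longlonglongrightarrow> p" if "\<forall>n. u (Suc n) = (1 - l) *\<^sub>R u n + l *\<^sub>R T (u n)" for u
  proof -
    have "u (Suc n) = S (u n)" for n
      using that by (simp add: S_def)
    from orbit[of u, OF this] obtain q where q: "u \<longlonglongrightarrow> q" "S q = q"
      by (elim exE conjE)
    with unique[OF q(2)] show ?thesis by simp
  qed
  moreover have "T p = p"
    using p by (simp add: fixed_iff)
  moreover have "q = p" if "T q = q" for q
    using that by (intro unique) (simp add: fixed_iff)
  moreover have "l \<in> {0<..1}"
    using l by simp
  ultimately show ?thesis
    by (intro exI[of _ p] conjI bexI[of _ l] allI impI)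
qed

end
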